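(* Let $n,k\ge1$ be integers, let $x=(x_1,\ldots,x_n)^T$ be a valid bid vector with blocks $x_r=(x_{r,1},\ldots,x_{r,k})^T$, and let $l=M\cdot x$, with blocks $l_r=(l_{r,1},\ldots,l_{r,k})^T$, where $M$ is the $nk\times nk$ matrix defined in the context. Then the entries of $x$ satisfy $$x_{1,k}=1-l_{1,k},\qquad x_{r,k}=1-l_{r,k}+\sum_{i=1}^{r-1}x_{i,k}\quad(1<r\le n),$$ $$x_{1,t}=1-l_{1,t}+\sum_{j=t+1}^{k}\sum_{i=2}^{n}x_{i,j}\quad(1\le t<k),$$ $$x_{r,t}=1-l_{r,t}+\sum_{i=1}^{r-1}x_{i,t}+\sum_{j=t+1}^{k}\ \sum_{i=1,\,i\ne r}^{n}x_{i,j}\quad(1\le t<k,\ 1<r\le n).$$ Evaluating these formulas in the order $t=k,k-1,\ldots,1$, and for each $t$ in the order $r=1,\ldots,n$, every right-hand side involves only entries of $l$ and already computed entries of $x$; hence $x$ is recovered from $l$, with a number of arithmetic operations (additions and subtractions) bounded by $$\sum_{r=1}^{n}\sum_{t=1}^{k}\bigl(r+(k-t)n\bigr)=\tfrac12 n^2k^2+o(n^2k^2)\qquad\text{as } nk\to\infty.$$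
   Context: Let $I$ be the $k\times k$ identity matrix, $L$ the $k\times k$ strictly lower triangular matrix with all entries strictly below the diagonal equal to $1$ and all other entries $0$, and $U$ the $k\times k$ strictly upper triangular matrix with all entries strictly above the diagonal equal to $1$ and all other entries $0$. Let $M$ be the $nk\times nk$ integer matrix consisting of $n\times n$ blocks of size $k\times k$, whose $(r,s)$ block is $U+L$ if $r=s$, $U$ if $r<s$, and $U+I$ if $r>s$. A valid bid vector is a column vector in $\mathbb{Z}^{nk}$ obtained by concatenating $n$ blocks of length $k$, each of which is a vector of the canonical basis of $\mathbb{Z}^k$. *)

theory Defs
  imports "Jordan_Normal_Form.Matrix" "HOL-Library.Landau_Symbols"
begin

definition lower_ones :: "nat \<Rightarrow> int mat" where
  "lower_ones k = mat k k (\<lambda>(i, j). if j < i then 1 else 0)"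

definition upper_ones :: "nat \<Rightarrow> int mat" where
  "upper_ones k = mat k k (\<lambda>(i, j). if i < j then 1 else 0)"

definition bid_block :: "nat \<Rightarrow> nat \<Rightarrow> nat \<Rightarrow> int mat" where
  "bid_block k r s =
     (if r = s then upper_ones k + lower_ones k
      else if r < s then upper_ones k
      else upper_ones k + 1\<^sub>m k)"

text \<open>Matrix and vector indices of the library start at 0, so position \<open>i\<close> lies in the
  block with (0-based) number \<open>i div k\<close>, at offset \<open>i mod k\<close>.\<close>

definition bid_matrix :: "nat \<Rightarrow> nat \<Rightarrow> int mat" where
  "bid_matrix n k =
     mat (n * k) (n * k) (\<lambda>(i, j). bid_block k (i div k) (j div k) $$ (i mod k, j mod k))"

text \<open>From here on blocks and their entries are numbered from 1, as on paper:
  \<open>entry k v r t\<close> is the \<open>t\<close>-th entry of the \<open>r\<close>-th block of \<open>v\<close>.\<close>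

definition entry :: "nat \<Rightarrow> int vec \<Rightarrow> nat \<Rightarrow> nat \<Rightarrow> int" where
  "entry k v r t = v $ ((r - 1) * k + (t - 1))"

definition block :: "nat \<Rightarrow> int vec \<Rightarrow> nat \<Rightarrow> int vec" where
  "block k v r = vec k (\<lambda>j. entry k v r (j + 1))"

definition valid_bid :: "nat \<Rightarrow> nat \<Rightarrow> int vec \<Rightarrow> bool" where
  "valid_bid n k x \<longleftrightarrow>
     x \<in> carrier_vec (n * k) \<and> (\<forall>r\<in>{1..n}. \<exists>j<k. block k x r = unit_vec k j)"

text \<open>Straight-line programs over the integers whose only operations are additions and
  subtractions. \<open>LVar r t\<close> reads the input entry \<open>l\<^sub>r\<^sub>,\<^sub>t\<close>; \<open>XVar r t\<close> reads the store cell that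
  is meant to hold \<open>x\<^sub>r\<^sub>,\<^sub>t\<close>.\<close>

datatype expr =
    Const int
  | LVar nat nat
  | XVar nat nat
  | Add expr expr
  | Sub expr expr

fun eval :: "(nat \<Rightarrow> nat \<Rightarrow> int) \<Rightarrow> (nat \<Rightarrow> nat \<Rightarrow> int) \<Rightarrow> expr \<Rightarrow> int" where
  "eval l x (Const c) = c"
| "eval l x (LVar r t) = l r t"
| "eval l x (XVar r t) = x r t"
| "eval l x (Add a b) = eval l x a + eval l x b"
| "eval l x (Sub a b) = eval l x a - eval l x b"

fun ops :: "expr \<Rightarrow> nat" where
  "ops (Add a b) = ops a + ops b + 1"
| "ops (Sub a b) = ops a + ops b + 1"
| "ops _ = 0"

fun lvars :: "expr \<Rightarrow> (nat \<times> nat) set" where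
  "lvars (LVar r t) = {(r, t)}"
| "lvars (Add a b) = lvars a \<union> lvars b"
| "lvars (Sub a b) = lvars a \<union> lvars b"
| "lvars _ = {}"

fun xvars :: "expr \<Rightarrow> (nat \<times> nat) set" where
  "xvars (XVar r t) = {(r, t)}"
| "xvars (Add a b) = xvars a \<union> xvars b"
| "xvars (Sub a b) = xvars a \<union> xvars b"
| "xvars _ = {}"

type_synonym program = "((nat \<times> nat) \<times> expr) list"

fun run :: "(nat \<Rightarrow> nat \<Rightarrow> int) \<Rightarrow> program \<Rightarrow> (nat \<Rightarrow> nat \<Rightarrow> int) \<Rightarrow> (nat \<Rightarrow> nat \<Rightarrow> int)" where
  "run l [] x = x"
| "run l (((r, t), e) # p) x = run l p (x(r := (x r)(t := eval l x e)))"

definition total_ops :: "program \<Rightarrow> nat" where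
  "total_ops p = (\<Sum>(v, e)\<leftarrow>p. ops e)"

definition rhs :: "nat \<Rightarrow> nat \<Rightarrow> nat \<Rightarrow> nat \<Rightarrow> expr" where
  "rhs n k r t = foldl Add (Sub (Const 1) (LVar r t))
     (if t = k then
        (if r = 1 then [] else [XVar i k. i \<leftarrow> [1..<r]])
      else if r = 1 then
        [XVar i j. j \<leftarrow> [t+1..<k+1], i \<leftarrow> [2..<n+1]]
      else
        [XVar i t. i \<leftarrow> [1..<r]] @ [XVar i j. j \<leftarrow> [t+1..<k+1], i \<leftarrow> [1..<n+1], i \<noteq> r])"

definition recovery :: "nat \<Rightarrow> nat \<Rightarrow> program" where
  "recovery n k = [((r, t), rhs n k r t). t \<leftarrow> rev [1..<k+1], r \<leftarrow> [1..<n+1]]"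

lemma eval_foldl_Add: "eval l x (foldl Add e es) = eval l x e + (\<Sum>a\<leftarrow>es. eval l x a)"
  by (induction es arbitrary: e) auto

lemma sum_list_nested:
  "(\<Sum>a\<leftarrow>concat (map f js). g a) = (\<Sum>j\<leftarrow>js. \<Sum>a\<leftarrow>f j. (g a :: int))"
  by (induction js) auto

lemma sum_list_guard:
  "(\<Sum>a\<leftarrow>(if P then [b] else []). g a) = (if P then (g b :: int) else 0)"
  by simp

text \<open>For arbitrary \<open>l\<close> and \<open>x\<close>, the expressions denote the intended right-hand sides.\<close>

lemma eval_rhs:
  "eval l x (rhs n k 1 k) = 1 - l 1 k"
  "1 < r \<Longrightarrow> eval l x (rhs n k r k) = 1 - l r k + (\<Sum>i=1..r-1. x i k)"
  "t < k \<Longrightarrow> eval l x (rhs n k 1 t) = 1 - l 1 t + (\<Sum>j=t+1..k. \<Sum>i=2..n. x i j)"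
  "t < k \<Longrightarrow> 1 < r \<Longrightarrow> eval l x (rhs n k r t) =
     1 - l r t + (\<Sum>i=1..r-1. x i t) + (\<Sum>j=t+1..k. \<Sum>i\<in>{1..n} - {r}. x i j)"
proof -
  have ivl: "(\<Sum>i\<leftarrow>[a..<b]. f i) = (\<Sum>i\<in>{a..<b}. f i)" for a b and f :: "nat \<Rightarrow> int"
    by (simp add: interv_sum_list_conv_sum_set_nat)
  have s1: "{a..<r} = {a..r-1}" if "1 < r" for a r :: nat
    using that by auto
  have s2: "{a..<Suc m} = {a..m}" for a m :: nat
    by auto
  have g: "(\<Sum>i\<in>{1..n}. if i \<noteq> r then f i else 0) = (\<Sum>i\<in>{1..n} - {r}. f i)"
    for r :: nat and f :: "nat \<Rightarrow> int"
    by (rule sum.mono_neutral_cong_right) auto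
  show "eval l x (rhs n k 1 k) = 1 - l 1 k"
    by (simp add: rhs_def)
  show "eval l x (rhs n k r k) = 1 - l r k + (\<Sum>i=1..r-1. x i k)" if "1 < r"
    using that by (simp add: rhs_def eval_foldl_Add o_def ivl s1 del: upt_Suc)
  show "eval l x (rhs n k 1 t) = 1 - l 1 t + (\<Sum>j=t+1..k. \<Sum>i=2..n. x i j)" if "t < k"
    using that by (simp add: rhs_def eval_foldl_Add sum_list_nested o_def ivl s2 del: upt_Suc)
  show "eval l x (rhs n k r t) =
     1 - l r t + (\<Sum>i=1..r-1. x i t) + (\<Sum>j=t+1..k. \<Sum>i\<in>{1..n} - {r}. x i j)"
    if "t < k" "1 < r"
    using that g[of r]
    by (simp add: rhs_def eval_foldl_Add sum_list_nested sum_list_guard o_def ivl s1 s2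
        del: upt_Suc)
qed

end

(* Multiplying out row t of block r of l = M x and using that block r of x sums to 1 gives a single
   identity that covers all four formulas. The program visits the positions in a strict linear order
   in which every right-hand side reads smaller positions only, so induction along the program shows
   that it computes x. The operation bound equals (n^2 k^2 + n k) / 2. *)
theory Submission imports Defs begin

section \<open>Block structure of the matrix-vector product\<close>

lemma sum_lessThan_mult:
  fixes f :: "nat \<Rightarrow> 'a::comm_monoid_add"
  shows "(\<Sum>i<n * k. f i) = (\<Sum>s<n. \<Sum>c<k. f (s * k + c))"
proof -
  have "(\<Sum>i<n * k. f i) = (\<Sum>s<n. sum f {s * k..<s * k + k})"
    by (rule sum.nat_group[symmetric])
  also have "\<dots> = (\<Sum>s<n. \<Sum>c<k. f (s * k + c))"
  proof (rule sum.cong)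
    show "sum f {s * k..<s * k + k} = (\<Sum>c<k. f (s * k + c))" for s
      using sum.shift_bounds_nat_ivl[of f 0 "s * k" k] by (simp add: atLeast0LessThan add.commute)
  qed simp
  finally show ?thesis .
qed

lemma block_index_less:
  fixes i j k n :: nat
  assumes "i < n" "j < k"
  shows "i * k + j < n * k"
proof -
  have "i * k + j < Suc i * k" using assms by simp
  also have "\<dots> \<le> n * k" using assms by (intro mult_le_mono1) simp
  finally show ?thesis .
qed

text \<open>The three indicators are the contributions of U, I and L: U sits in every block, I is
  added below the block diagonal, L on it. Only comparisons of \<open>r\<close> and \<open>s\<close>
  matter, so the formula serves both 0-based and 1-based block numbers.\<close>

lemma bid_block_index:
  assumes "i < k" "j < k"
  shows "bid_block k r s $$ (i, j) =
    of_bool (i < j) + of_bool (j = i \<and> s < r) + of_bool (j < i \<and> s = r)"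
  using assms by (auto simp: bid_block_def upper_ones_def lower_ones_def)

text \<open>The three sums come from U, I and L in this order: U collects the later offsets of all
  blocks, I the same offset of the earlier blocks, L the earlier offsets of block \<open>r\<close>
  itself.\<close>

lemma entry_bid_matrix_mult:
  assumes x: "x \<in> carrier_vec (n * k)" and r: "r \<in> {1..n}" and t: "t \<in> {1..k}"
  shows "entry k (bid_matrix n k *\<^sub>v x) r t =
    (\<Sum>j=t+1..k. \<Sum>s=1..n. entry k x s j) + (\<Sum>s=1..r-1. entry k x s t)
    + (\<Sum>j=1..t-1. entry k x r j)"
proof -
  have row: "(r - 1) * k + (t - 1) < n * k"
    using r t by (intro block_index_less) auto
  have k: "0 < k" using t by auto
  have div: "(a * k + b) div k = a" "(a * k + b) mod k = b" if "b < k" for a b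
    using that by auto
  have "entry k (bid_matrix n k *\<^sub>v x) r t =
      (\<Sum>i<n * k. bid_matrix n k $$ ((r - 1) * k + (t - 1), i) * x $ i)"
    using row x by (simp add: entry_def bid_matrix_def scalar_prod_def atLeast0LessThan)
  also have "\<dots> = (\<Sum>s<n. \<Sum>c<k.
      bid_block k (r - 1) s $$ (t - 1, c) * entry k x (Suc s) (Suc c))"
    unfolding sum_lessThan_mult
  proof (intro sum.cong refl)
    fix s c assume "s \<in> {..<n}" "c \<in> {..<k}"
    then have "s * k + c < n * k" "c < k" by (auto intro: block_index_less)
    moreover have "t - 1 < k" using t by auto
    ultimately show "bid_matrix n k $$ ((r - 1) * k + (t - 1), s * k + c) * x $ (s * k + c) =
        bid_block k (r - 1) s $$ (t - 1, c) * entry k x (Suc s) (Suc c)"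
      using row by (simp add: bid_matrix_def entry_def div)
  qed
  \<comment> \<open>Both indices are shifted to the 1-based numbering used by \<open>entry\<close>;
    the subtractions are exact because \<open>s\<close> and \<open>j\<close> start at 1.\<close>
  also have "\<dots> = (\<Sum>s=1..n. \<Sum>j=1..k.
      bid_block k (r - 1) (s - 1) $$ (t - 1, j - 1) * entry k x s j)"
    by (simp add: sum.atLeast1_atMost_eq)
  \<comment> \<open>The conditions are nested with the equation outermost, so that a sum over
    \<open>j = t\<close> or \<open>s = r\<close> collapses to one term.\<close>
  also have "\<dots> = (\<Sum>s=1..n. \<Sum>j=1..k. (if t < j then entry k x s j else 0)
      + (if j = t then if s < r then entry k x s j else 0 else 0)
      + (if s = r then if j < t then entry k x s j else 0 else 0))"
  proof (intro sum.cong refl)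
    fix s j assume "s \<in> {1..n}" "j \<in> {1..k}"
    then have "bid_block k (r - 1) (s - 1) $$ (t - 1, j - 1) =
        of_bool (t < j) + of_bool (j = t \<and> s < r) + of_bool (j < t \<and> s = r)"
      using r t by (subst bid_block_index) auto
    then show "bid_block k (r - 1) (s - 1) $$ (t - 1, j - 1) * entry k x s j =
      (if t < j then entry k x s j else 0)
      + (if j = t then if s < r then entry k x s j else 0 else 0)
      + (if s = r then if j < t then entry k x s j else 0 else 0)"
      by auto
  qed
  also have "\<dots> = (\<Sum>s=1..n. \<Sum>j=1..k. if t < j then entry k x s j else 0)
      + (\<Sum>s=1..n. if s < r then entry k x s t else 0)
      + (\<Sum>j=1..k. if j < t then entry k x r j else 0)"
  proof -
    \<comment> \<open>The equation \<open>s = r\<close> constrains the outer index, so the sums are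
      swapped before collapsing.\<close>
    have "(\<Sum>s=1..n. \<Sum>j=1..k. if s = r then if j < t then entry k x s j else 0 else 0) =
        (\<Sum>j=1..k. \<Sum>s=1..n. if s = r then if j < t then entry k x s j else 0 else 0)"
      by (rule sum.swap)
    then show ?thesis
      using r t by (simp add: sum.distrib)
  qed
  also have "(\<Sum>s=1..n. \<Sum>j=1..k. if t < j then entry k x s j else 0) =
      (\<Sum>j=t+1..k. \<Sum>s=1..n. entry k x s j)"
  proof -
    have "(\<Sum>j=1..k. if t < j then entry k x s j else 0) = (\<Sum>j=t+1..k. entry k x s j)" for s
      using t by (intro sum.mono_neutral_cong_right) auto
    then show ?thesis
      by (simp only: sum.swap[where A = "{1..n}"])
  qed
  also have "(\<Sum>s=1..n. if s < r then entry k x s t else 0) = (\<Sum>s=1..r-1. entry k x s t)"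
    using r by (intro sum.mono_neutral_cong_right) auto
  also have "(\<Sum>j=1..k. if j < t then entry k x r j else 0) = (\<Sum>j=1..t-1. entry k x r j)"
    using t by (intro sum.mono_neutral_cong_right) auto
  finally show ?thesis .
qed

section \<open>The recovery identity for valid bids\<close>

lemma valid_bid_row_sum:
  assumes "valid_bid n k x" "r \<in> {1..n}"
  shows "(\<Sum>j=1..k. entry k x r j) = 1"
proof -
  obtain c where c: "c < k" "block k x r = unit_vec k c"
    using assms unfolding valid_bid_def by blast
  have "entry k x r (Suc j) = (if j = c then 1 else 0)" if "j < k" for j
    using arg_cong[OF c(2), of "\<lambda>v. v $ j"] that c(1) by (simp add: block_def)
  then have "(\<Sum>j<k. entry k x r (Suc j)) = (\<Sum>j<k. if j = c then 1 else 0)"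
    by (intro sum.cong) auto
  then show ?thesis
    using c(1) by (simp add: sum.atLeast1_atMost_eq)
qed

text \<open>Since block \<open>r\<close> sums to 1, its entries before \<open>t\<close>, which are
  the contribution of L, can be expressed by those from \<open>t\<close> on. The entries after
  \<open>t\<close> then cancel against the share of block \<open>r\<close> in the U part, which is
  why \<open>r\<close> is missing from the last sum.\<close>

lemma entry_recovery:
  assumes v: "valid_bid n k x" and r: "r \<in> {1..n}" and t: "t \<in> {1..k}"
  shows "entry k x r t = 1 - entry k (bid_matrix n k *\<^sub>v x) r t
    + (\<Sum>i=1..r-1. entry k x i t) + (\<Sum>j=t+1..k. \<Sum>i\<in>{1..n} - {r}. entry k x i j)"
proof -
  have x: "x \<in> carrier_vec (n * k)" using v by (simp add: valid_bid_def)
  have "{1..k} = {1..t-1} \<union> ({t} \<union> {t+1..k})" using t by auto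
  then have "(\<Sum>j=1..k. entry k x r j) =
      (\<Sum>j=1..t-1. entry k x r j) + (entry k x r t + (\<Sum>j=t+1..k. entry k x r j))"
    using t by (simp only:, subst sum.union_disjoint) auto
  then have row: "(\<Sum>j=1..t-1. entry k x r j) + entry k x r t + (\<Sum>j=t+1..k. entry k x r j) = 1"
    using valid_bid_row_sum[OF v r] by simp
  \<comment> \<open>The term \<open>i = r\<close> is split off for each \<open>j\<close>, to be
    cancelled by means of \<open>row\<close>.\<close>
  have "(\<Sum>j=t+1..k. \<Sum>i=1..n. entry k x i j) =
      (\<Sum>j=t+1..k. entry k x r j) + (\<Sum>j=t+1..k. \<Sum>i\<in>{1..n} - {r}. entry k x i j)"
    unfolding sum.distrib[symmetric] using r by (intro sum.cong refl sum.remove) auto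
  then show ?thesis
    using row entry_bid_matrix_mult[OF x r t] by simp
qed

lemma eval_rhs_entry:
  assumes "valid_bid n k x" "r \<in> {1..n}" "t \<in> {1..k}"
  shows "eval (entry k (bid_matrix n k *\<^sub>v x)) (entry k x) (rhs n k r t) = entry k x r t"
proof -
  have "{1..n} - {Suc 0} = {2..n}" by auto
  then show ?thesis
    using entry_recovery[OF assms] assms(2,3)
    \<comment> \<open>The sums over \<open>j\<close> or over \<open>i < r\<close> are empty in the
      boundary cases. Simplification turns \<open>1\<close> into \<open>Suc 0\<close>, hence the
      second form of \<open>eval_rhs\<close>.\<close>
    by (cases "t = k"; cases "r = 1") (simp_all add: eval_rhs eval_rhs[unfolded One_nat_def])
qed

section \<open>Correctness of straight-line programs\<close>

lemma eval_cong:
  assumes "\<And>r t. (r, t) \<in> xvars e \<Longrightarrow> x r t = y r t"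
  shows "eval l x e = eval l y e"
  using assms by (induction e) auto

lemma run_append: "run l (p @ q) x = run l q (run l p x)"
  by (induction l p x rule: run.induct) (simp_all del: fun_upd_apply)

text \<open>If \<open>x\<close> solves the assignments read as equations and every assignment reads
  only cells written before it, then each assignment writes the value of \<open>x\<close>, whatever
  the initial store. Writing a cell twice does no harm, as both values agree with
  \<open>x\<close>.\<close>

lemma run_correct:
  assumes "\<And>i. i < length p \<Longrightarrow> xvars (snd (p ! i)) \<subseteq> fst ` set (take i p)"
    and "\<And>r t e. ((r, t), e) \<in> set p \<Longrightarrow> eval l x e = x r t"
    and "(r, t) \<in> fst ` set p"
  shows "run l p init r t = x r t"
  using assms
\<comment> \<open>The last assignment is split off because the condition on \<open>take i p\<close>
  passes to prefixes, not to suffixes.\<close>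
proof (induction p arbitrary: r t rule: rev_induct)
  case Nil
  then show ?case by simp
next
  case (snoc a p)
  obtain r' t' e where a: "a = ((r', t'), e)" by (metis prod.collapse)
  have IH: "run l p init u v = x u v" if "(u, v) \<in> fst ` set p" for u v
  proof (rule snoc.IH)
    fix i assume "i < length p"
    then show "xvars (snd (p ! i)) \<subseteq> fst ` set (take i p)"
      using snoc.prems(1)[of i] by (simp add: nth_append)
  next
    fix r t e assume "((r, t), e) \<in> set p"
    then show "eval l x e = x r t"
      using snoc.prems(2) by simp
  qed (rule that)
  have "xvars e \<subseteq> fst ` set p"
    using snoc.prems(1)[of "length p"] a by simp
  then have "eval l (run l p init) e = eval l x e"
    by (intro eval_cong IH) auto
  also have "\<dots> = x r' t'" using snoc.prems(2) a by simp
  finally have upd: "eval l (run l p init) e = x r' t'" .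
  show ?case
    using snoc.prems(3) IH[of r t] by (auto simp: a run_append upd)
qed

section \<open>Evaluation order and the variables read\<close>

definition eval_order :: "nat \<times> nat \<Rightarrow> nat \<times> nat \<Rightarrow> bool" where
  "eval_order u v \<longleftrightarrow> snd v < snd u \<or> (snd u = snd v \<and> fst u < fst v)"

lemma set_recovery:
  "set (recovery n k) = (\<lambda>(r, t). ((r, t), rhs n k r t)) ` ({1..n} \<times> {1..k})"
  by (force simp: recovery_def)

lemma sorted_wrt_concat_map:
  assumes "sorted_wrt (\<lambda>a b. \<forall>u \<in> set (f a). \<forall>v \<in> set (f b). R u v) xs"
    and "\<And>a. a \<in> set xs \<Longrightarrow> sorted_wrt R (f a)"
  shows "sorted_wrt R (concat (map f xs))"
  using assms by (induction xs) (auto simp: sorted_wrt_append)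

text \<open>Each inner list has a fixed \<open>t\<close> and increasing \<open>r\<close>; from one
  inner list to the next, \<open>t\<close> decreases.\<close>

lemma sorted_wrt_recovery: "sorted_wrt (\<lambda>a b. eval_order (fst a) (fst b)) (recovery n k)"
  unfolding recovery_def
  by (rule sorted_wrt_concat_map)
     (auto simp: eval_order_def sorted_wrt_rev sorted_wrt_map simp del: upt_Suc
       intro: sorted_wrt_mono_rel[OF _ sorted_wrt_upt])

lemma lvars_foldl_Add: "lvars (foldl Add e es) = lvars e \<union> \<Union> (lvars ` set es)"
  by (induction es arbitrary: e) auto

lemma xvars_foldl_Add: "xvars (foldl Add e es) = xvars e \<union> \<Union> (xvars ` set es)"
  by (induction es arbitrary: e) auto

lemma ops_foldl_Add: "ops (foldl Add e es) = ops e + (\<Sum>a\<leftarrow>es. ops a + 1)"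
  by (induction es arbitrary: e) auto

lemma lvars_rhs: "lvars (rhs n k r t) = {(r, t)}"
  by (auto simp: rhs_def lvars_foldl_Add split: if_splits)

text \<open>A variable that is read has either the same offset \<open>t\<close> and a smaller block
  number, or a larger offset; both kinds precede \<open>(r, t)\<close>.\<close>

lemma xvars_rhs:
  assumes "r \<in> {1..n}" "t \<in> {1..k}"
  shows "xvars (rhs n k r t) \<subseteq> {u \<in> {1..n} \<times> {1..k}. eval_order u (r, t)}"
  using assms
  by (auto simp: rhs_def xvars_foldl_Add eval_order_def simp del: upt_Suc split: if_splits)

section \<open>Operation count of one right-hand side\<close>

lemma sum_list_le_length_mult:
  fixes f :: "'a \<Rightarrow> nat"
  assumes "\<And>a. a \<in> set xs \<Longrightarrow> f a \<le> c"
  shows "(\<Sum>a\<leftarrow>xs. f a) \<le> length xs * c"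
  using assms by (induction xs) (auto intro: add_mono)

lemma sum_list_concat_map_nat: "(\<Sum>a\<leftarrow>concat (map f js). g a) = (\<Sum>j\<leftarrow>js. \<Sum>a\<leftarrow>f j. (g a :: nat))"
  by (induction js) auto

text \<open>The initial subtraction costs one operation and every summand one addition. There are at
  most \<open>r - 1\<close> summands with offset \<open>t\<close>, and at most \<open>n\<close> for
  each of the \<open>k - t\<close> later offsets.\<close>

lemma ops_rhs_le:
  assumes r: "r \<in> {1..n}" and t: "t \<in> {1..k}"
  shows "ops (rhs n k r t) \<le> r + (k - t) * n"
proof -
  \<comment> \<open>The guard leaves at most one variable for each \<open>i\<close>, and a variable
    itself costs nothing.\<close>
  have inner: "(\<Sum>a\<leftarrow>concat (map (\<lambda>i. if P i then [XVar i j] else []) [1..<n+1]). ops a + 1) \<le> n"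
    for P j
  proof -
    have "(\<Sum>i\<leftarrow>[1..<n+1]. \<Sum>a\<leftarrow>(if P i then [XVar i j] else []). ops a + 1) \<le>
        length [1..<n+1] * 1"
      by (rule sum_list_le_length_mult) simp
    then show ?thesis unfolding sum_list_concat_map_nat by (simp del: upt_Suc)
  qed
  have outer: "(\<Sum>a\<leftarrow>concat (map f [t+1..<k+1]). ops a + 1) \<le> (k - t) * n"
    if "\<And>j. (\<Sum>a\<leftarrow>f j. ops a + 1) \<le> n" for f
    using sum_list_le_length_mult[of "[t+1..<k+1]" "\<lambda>j. \<Sum>a\<leftarrow>f j. ops a + 1" n] that
    by (simp add: sum_list_concat_map_nat[of _ f] del: upt_Suc)
  consider "t = k" | "t \<noteq> k" "r = 1" | "t \<noteq> k" "r \<noteq> 1" by blast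
  then show ?thesis
  proof cases
    case 1
    then show ?thesis
      using r by (auto simp: rhs_def ops_foldl_Add o_def sum_list_triv)
  next
    case 2
    have "(\<Sum>a\<leftarrow>concat (map (\<lambda>j. map (\<lambda>i. XVar i j) [2..<n+1]) [t+1..<k+1]). ops a + 1) \<le> (k - t) * n"
      by (rule outer) (simp add: o_def sum_list_triv del: upt_Suc)
    then show ?thesis
      using 2 by (simp add: rhs_def ops_foldl_Add del: upt_Suc map_map)
  next
    case 3
    have "(\<Sum>a\<leftarrow>concat (map (\<lambda>j. concat (map (\<lambda>i. if i \<noteq> r then [XVar i j] else []) [1..<n+1]))
        [t+1..<k+1]). ops a + 1) \<le> (k - t) * n"
      by (rule outer) (rule inner)
    moreover have "(\<Sum>a\<leftarrow>map (\<lambda>i. XVar i t) [1..<r]. ops a + 1) = r - 1"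
      by (simp add: o_def sum_list_triv)
    ultimately show ?thesis
      using 3 r by (simp add: rhs_def ops_foldl_Add del: upt_Suc map_map)
  qed
qed

section \<open>Dependencies and correctness of the recovery program\<close>

lemma recovery_dependencies:
  assumes p: "p < length (recovery n k)"
  shows "lvars (snd (recovery n k ! p)) \<subseteq> {1..n} \<times> {1..k}"
    and "xvars (snd (recovery n k ! p)) \<subseteq> fst ` set (take p (recovery n k))"
proof -
  let ?R = "recovery n k"
  obtain r t where rt: "r \<in> {1..n}" "t \<in> {1..k}" "?R ! p = ((r, t), rhs n k r t)"
    using nth_mem[OF p] unfolding set_recovery by auto
  show "lvars (snd (?R ! p)) \<subseteq> {1..n} \<times> {1..k}"
    using rt by (simp add: lvars_rhs)
  show "xvars (snd (?R ! p)) \<subseteq> fst ` set (take p ?R)"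
  proof
    fix u assume "u \<in> xvars (snd (?R ! p))"
    then have u: "u \<in> {1..n} \<times> {1..k}" "eval_order u (r, t)"
      using xvars_rhs[OF rt(1,2)] rt(3) by auto
    have "u \<in> fst ` set ?R" using u(1) by (force simp: set_recovery)
    then obtain q where q: "q < length ?R" "u = fst (?R ! q)"
      by (auto simp: in_set_conv_nth)
    \<comment> \<open>If \<open>q\<close> were at least \<open>p\<close>, sortedness would place
      \<open>u\<close> at or after \<open>(r, t)\<close>, against the strict order.\<close>
    have "\<not> p \<le> q"
    proof
      assume "p \<le> q"
      then have "q = p \<or> eval_order (r, t) u"
        using sorted_wrt_nth_less[OF sorted_wrt_recovery, of p q n k] q rt(3)
        by (cases "q = p") auto
      moreover have "u = (r, t)" if "q = p" using that q(2) rt(3) by simp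
      ultimately show False
        using u(2) unfolding eval_order_def by (metis less_asym less_irrefl)
    qed
    then show "u \<in> fst ` set (take p ?R)"
      using q by (force simp: in_set_conv_nth)
  qed
qed

lemma run_recovery:
  assumes "valid_bid n k x" "r \<in> {1..n}" "t \<in> {1..k}"
  shows "run (entry k (bid_matrix n k *\<^sub>v x)) (recovery n k) init r t = entry k x r t"
proof (rule run_correct)
  show "eval (entry k (bid_matrix n k *\<^sub>v x)) (entry k x) e = entry k x r t"
    if "((r, t), e) \<in> set (recovery n k)" for r t e
    using that eval_rhs_entry[OF assms(1)] by (auto simp: set_recovery)
  show "(r, t) \<in> fst ` set (recovery n k)"
    using assms by (force simp: set_recovery)
qed (rule recovery_dependencies)

section \<open>Total operation count and its asymptotics\<close>

lemma total_ops_recovery_le: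
  "total_ops (recovery n k) \<le> (\<Sum>r=1..n. \<Sum>t=1..k. r + (k - t) * n)"
proof -
  have "total_ops (recovery n k) = (\<Sum>t\<leftarrow>rev [1..<k+1]. \<Sum>r\<leftarrow>[1..<n+1]. ops (rhs n k r t))"
    by (simp add: total_ops_def recovery_def sum_list_concat_map_nat o_def del: upt_Suc)
  also have "\<dots> = (\<Sum>t=1..k. \<Sum>r=1..n. ops (rhs n k r t))"
    by (simp add: rev_map[symmetric] interv_sum_list_conv_sum_set_nat
      atLeastLessThanSuc_atLeastAtMost del: upt_Suc)
  also have "\<dots> \<le> (\<Sum>t=1..k. \<Sum>r=1..n. r + (k - t) * n)"
    by (intro sum_mono ops_rhs_le)
  also have "\<dots> = (\<Sum>r=1..n. \<Sum>t=1..k. r + (k - t) * n)"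
    by (rule sum.swap)
  finally show ?thesis .
qed

text \<open>The terms of order n^2 k from the two Gauss sums cancel, leaving exactly nk/2 beside the
  leading term.\<close>

lemma ops_bound_eq:
  "real (\<Sum>r=1..n. \<Sum>t=1..k. r + (k - t) * n) =
    1/2 * real n ^ 2 * real k ^ 2 + real n * real k / 2"
proof -
  have gauss: "real (\<Sum>i=1..m. i) = real m * (real m + 1) / 2" for m
    by (induction m) (auto simp: field_simps)
  \<comment> \<open>The left sum runs through 0 to k-1; adding \<open>k\<close> on the left keeps
    the identity free of subtraction between sums of naturals.\<close>
  have rev: "(\<Sum>t=1..k. k - t) + k = (\<Sum>t=1..k. t)"
  proof (induction k)
    case (Suc k)
    have "(\<Sum>t=1..Suc k. Suc k - t) = (\<Sum>t=1..k. (k - t) + 1)"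
      by (simp add: Suc_diff_le)
    also have "\<dots> = (\<Sum>t=1..k. k - t) + k"
      by (simp only: sum.distrib) simp
    finally show ?case
      using Suc by simp
  qed simp
  have "(\<Sum>r=1..n. \<Sum>t=1..k. r + (k - t) * n) = k * (\<Sum>r=1..n. r) + n * ((\<Sum>t=1..k. k - t) * n)"
    by (simp add: sum.distrib sum_distrib_left sum_distrib_right)
  then have "real (\<Sum>r=1..n. \<Sum>t=1..k. r + (k - t) * n) =
      real k * real (\<Sum>r=1..n. r) + real n * (real (\<Sum>t=1..k. k - t) * real n)"
    by (simp only: of_nat_add of_nat_mult)
  also have "real (\<Sum>t=1..k. k - t) = real (\<Sum>t=1..k. t) - real k"
    unfolding rev[symmetric] by simp
  finally show ?thesis
    unfolding gauss by (simp add: field_simps power2_eq_square)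
qed

text \<open>With m = nk the remainder is m/2, to be compared with m^2. The filter lets only the
  product tend to infinity, so one of \<open>n\<close> and \<open>k\<close> may stay
  bounded.\<close>

lemma ops_bound_asymptotics:
  "(\<lambda>(n, k). real (\<Sum>r=1..n. \<Sum>t=1..k. r + (k - t) * n) - 1/2 * real n ^ 2 * real k ^ 2)
    \<in> o[filtercomap (\<lambda>(n, k). n * k) at_top](\<lambda>(n, k). real n ^ 2 * real k ^ 2)"
proof (rule landau_o.smallI)
  fix c :: real assume c: "c > 0"
  \<comment> \<open>For positive m, the inequality m/2 \<le> c m^2 amounts to m \<ge>
    1/(2c).\<close>
  obtain N :: nat where N: "1 / (2 * c) \<le> real N" using real_arch_simple by blast
  have bound: "m / 2 \<le> c * m ^ 2" if "real N \<le> m" for m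
  proof -
    have "1 / (2 * c) \<le> m" using N that by linarith
    then have "1 \<le> 2 * c * m" using c by (simp add: field_simps)
    moreover have "0 \<le> m" using that by linarith
    ultimately have "1 * m \<le> 2 * c * m * m" by (rule mult_right_mono)
    then show ?thesis by (simp add: power2_eq_square)
  qed
  show "\<forall>\<^sub>F p in filtercomap (\<lambda>(n, k). n * k) at_top.
    norm (case p of (n, k) \<Rightarrow>
      real (\<Sum>r=1..n. \<Sum>t=1..k. r + (k - t) * n) - 1/2 * real n ^ 2 * real k ^ 2)
    \<le> c * norm (case p of (n, k) \<Rightarrow> real n ^ 2 * real k ^ 2)"
    unfolding eventually_filtercomap
  proof (intro exI conjI allI impI)
    show "eventually (\<lambda>m. N \<le> m) at_top" by (rule eventually_ge_at_top)
  next
    fix p :: "nat \<times> nat" assume "N \<le> (case p of (n, k) \<Rightarrow> n * k)"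
    then have "real N \<le> real (fst p) * real (snd p)"
      by (simp add: case_prod_beta flip: of_nat_mult)
    from bound[OF this]
    show "norm (case p of (n, k) \<Rightarrow>
        real (\<Sum>r=1..n. \<Sum>t=1..k. r + (k - t) * n) - 1/2 * real n ^ 2 * real k ^ 2)
      \<le> c * norm (case p of (n, k) \<Rightarrow> real n ^ 2 * real k ^ 2)"
      unfolding case_prod_beta ops_bound_eq by (simp add: power_mult_distrib)
  qed
qed

theorem mainTheorem2:
  fixes n k :: nat and x l :: "int vec" and X L :: "nat \<Rightarrow> nat \<Rightarrow> int"
  assumes "n \<ge> 1" and "k \<ge> 1"
    and "valid_bid n k x"
    and "l = bid_matrix n k *\<^sub>v x"
    and "X = entry k x"
    and "L = entry k l"
  shows
    "X 1 k = 1 - L 1 k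
     \<and> (\<forall>r. 1 < r \<and> r \<le> n \<longrightarrow>
          X r k = 1 - L r k + (\<Sum>i=1..r-1. X i k))
     \<and> (\<forall>t. 1 \<le> t \<and> t < k \<longrightarrow>
          X 1 t = 1 - L 1 t + (\<Sum>j=t+1..k. \<Sum>i=2..n. X i j))
     \<and> (\<forall>r t. 1 \<le> t \<and> t < k \<and> 1 < r \<and> r \<le> n \<longrightarrow>
          X r t = 1 - L r t + (\<Sum>i=1..r-1. X i t)
                  + (\<Sum>j=t+1..k. \<Sum>i\<in>{1..n} - {r}. X i j))
     \<and> (\<forall>p < length (recovery n k).
          lvars (snd (recovery n k ! p)) \<subseteq> {1..n} \<times> {1..k}
          \<and> xvars (snd (recovery n k ! p)) \<subseteq> fst ` set (take p (recovery n k)))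
     \<and> (\<forall>init. \<forall>r\<in>{1..n}. \<forall>t\<in>{1..k}. run L (recovery n k) init r t = X r t)
     \<and> total_ops (recovery n k) \<le> (\<Sum>r=1..n. \<Sum>t=1..k. r + (k - t) * n)
     \<and> (\<lambda>(n, k). real (\<Sum>r=1..n. \<Sum>t=1..k. r + (k - t) * n) - 1/2 * real n ^ 2 * real k ^ 2)
         \<in> o[filtercomap (\<lambda>(n, k). n * k) at_top](\<lambda>(n, k). real n ^ 2 * real k ^ 2)"
proof (intro conjI)
  have l: "L = entry k (bid_matrix n k *\<^sub>v x)" using assms by simp
  have eq: "X r t = 1 - L r t + (\<Sum>i=1..r-1. X i t) + (\<Sum>j=t+1..k. \<Sum>i\<in>{1..n} - {r}. X i j)"
    if "r \<in> {1..n}" "t \<in> {1..k}" for r t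
    using entry_recovery[OF assms(3) that] by (simp add: l assms(5))
  have drop1: "{1..n} - {1} = {2..n}" by auto
  \<comment> \<open>The four formulas are cases of \<open>eq\<close>: for \<open>t = k\<close> the
    double sum is empty, for \<open>r = 1\<close> the sum over earlier blocks is.\<close>
  show "X 1 k = 1 - L 1 k"
    using eq[of 1 k] assms(1,2) by simp
  show "\<forall>r. 1 < r \<and> r \<le> n \<longrightarrow> X r k = 1 - L r k + (\<Sum>i=1..r-1. X i k)"
    using eq[of _ k] assms(2) by simp
  show "\<forall>t. 1 \<le> t \<and> t < k \<longrightarrow> X 1 t = 1 - L 1 t + (\<Sum>j=t+1..k. \<Sum>i=2..n. X i j)"
    using eq[of 1, unfolded drop1] assms(1) by simp
  show "\<forall>r t. 1 \<le> t \<and> t < k \<and> 1 < r \<and> r \<le> n \<longrightarrow>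
      X r t = 1 - L r t + (\<Sum>i=1..r-1. X i t) + (\<Sum>j=t+1..k. \<Sum>i\<in>{1..n} - {r}. X i j)"
    using eq by simp
  show "\<forall>p < length (recovery n k).
      lvars (snd (recovery n k ! p)) \<subseteq> {1..n} \<times> {1..k}
      \<and> xvars (snd (recovery n k ! p)) \<subseteq> fst ` set (take p (recovery n k))"
    using recovery_dependencies by blast
  show "\<forall>init. \<forall>r\<in>{1..n}. \<forall>t\<in>{1..k}. run L (recovery n k) init r t = X r t"
    using run_recovery[OF assms(3)] by (simp add: l assms(5))
qed (rule total_ops_recovery_le ops_bound_asymptotics)+

end
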